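(* Let $H$ be a real Hilbert space, let $\mathsf{A},\mathsf{B}$ be maximal monotone operators on $H$ with $S:=\mathsf{A}^{-1}(0)\cap\mathsf{B}^{-1}(0)\neq\emptyset$, let $x_0,u\in H$, $(\alpha_n),(\lambda_n)\subset(0,1)$, $(\beta_n),(\mu_n)\subset(0,+\infty)$, and let $(y_n)$ be given by $y_0=x_0$ and $$y_{2n+1}=J^{\mathsf{A}}_{\beta_n}(\alpha_n u+(1-\alpha_n)y_{2n}),\qquad y_{2n+2}=J^{\mathsf{B}}_{\mu_n}(\lambda_n u+(1-\lambda_n)y_{2n+1})\qquad(n\in\mathbb{N}).$$ Let $N\in\mathbb{N}\setminus\{0\}$ be such that $N\geq\max\{2\|u-q\|,\|x_0-q\|,\|q\|\}$ for some point $q\in S$, and let $B_N:=\{z\in H:\|z-q\|\leq N\}$. Assume that there exist $R\in\mathbb{N}\setminus\{0\}$ and monotone functions $\Delta,t:\mathbb{N}\to\mathbb{N}$ such that - $\Delta$ is a rate of divergence for $\sum\alpha_n=\infty$ or for $\sum\lambda_n=\infty$; - $\min\{\beta_n,\mu_n\}\geq\frac1R$ for all $n\in\mathbb{N}$; - $\max\{\beta_n,\mu_n\}\leq t(n)$ for all $n\in\mathbb{N}$. Write $J^{\mathsf{A}}:=J^{\mathsf{A}}_{1/R}$, $J^{\mathsf{B}}:=J^{\mathsf{B}}_{1/R}$, and let $\eta:\mathbb{N}\times\mathbb{N}^{\mathbb{N}}\to\mathbb{N}$ be a monotone quasi-rate of asymptotic regularity for $(y_n)$ with respect to $J^{\mathsf{A}}$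 and $J^{\mathsf{B}}$. Then for all $k\in\mathbb{N}$ and all monotone $f:\mathbb{N}\to\mathbb{N}$ there exist $n\leq\widetilde{\mu}(k,f)$ and $x\in B_N$ such that $$\forall m\in[n,f(n)]\ \left(\|y_{2m}-x\|\leq\tfrac1{k+1}\ \wedge\ \|J^{\mathsf{A}}(x)-x\|\leq\tfrac1{k+1}\ \wedge\ \|J^{\mathsf{B}}(x)-x\|\leq\tfrac1{k+1}\right),$$ where $\widetilde{\mu}(k,f):=\sigma_1\big(\widetilde{k},\Omega_\eta(k',2g+2)\big)$ with $\widetilde{k}:=(k+1)^2-1$, $k':=16(k+1)^2-1$, $p(n):=f(\sigma_1(\widetilde{k},n))$, $g(n):=64NR(k+1)^2(p(n)+1)\,t(p(n))-1$, $2g+2$ denotes the function $n\mapsto 2g(n)+2$, and $\sigma_1$, $\Omega_\eta$ are the functions defined in the context.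
   Context: $\mathbb{N}=\{0,1,2,\dots\}$; $[n,p]$ denotes $\{m\in\mathbb{N}:n\leq m\leq p\}$ (empty if $p<n$). For $\gamma>0$, $J^{\mathsf{A}}_\gamma=(I+\gamma\mathsf{A})^{-1}$ is the (single-valued) resolvent of the maximal monotone operator $\mathsf{A}$. For $g,f:\mathbb{N}\to\mathbb{N}$, $g\leq^*f$ means: for all $m\leq n$, $g(m)\leq f(n)$ and $f(m)\leq f(n)$. A function $f:\mathbb{N}\to\mathbb{N}$ is monotone if it is nondecreasing. A functional $\varphi:\mathbb{N}\times\mathbb{N}^{\mathbb{N}}\to\mathbb{N}$ is monotone if $m\leq n$ and $g\leq^*f$ imply $\varphi(m,g)\leq\varphi(n,f)$. A rate of divergence for $\sum a_n=\infty$ is a function $\gamma:\mathbb{N}\to\mathbb{N}$ with $\sum_{i=0}^{\gamma(k)+n}a_i\geq k$ for all $k,n\in\mathbb{N}$. A quasi-rate of asymptotic regularity for $(y_n)$ with respect to $T,T':H\to H$ is a functional $\Gamma:\mathbb{N}\times\mathbb{N}^{\mathbb{N}}\to\mathbb{N}$ such that for all $k\in\mathbb{N}$ and $f:\mathbb{N}\to\mathbb{N}$ there is $n\leq\Gamma(k,f)$ with $\max\{\|T(y_m)-y_m\|,\|T'(y_m)-y_m\|\}\leq\frac1{k+1}$ for all $m\in[n,f(n)]$. Definitions of the functions: - $\sigma_1(k,n):=\Delta\big(n+\lceil\ln(16N^2(k+1))\rceil\big)+1$. - $\zeta(k,f):=24N\big(w_{f,N}^{(E)}(0)+1\big)^2$,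 where $w_{f,N}(m):=\max\{f(24N(m+1)^2),\,24N(m+1)^2\}$, $E:=4N^4(k+1)^2$, and $w^{(E)}$ is the $E$-fold iterate of $w$. - $\Omega_\eta(k,f):=\eta(\zeta(k,\widehat{f}),f)$, where $\widehat{f}(m):=f(\eta(m,f))$. *)

theory Defs
  imports "HOL-Analysis.Analysis"
begin

definition monotone_operator :: "('a::real_inner \<Rightarrow> 'a set) \<Rightarrow> bool" where
  "monotone_operator A \<longleftrightarrow>
     (\<forall>x y. \<forall>v\<in>A x. \<forall>w\<in>A y. (x - y) \<bullet> (v - w) \<ge> 0)"

text \<open>The pointwise order \<open>A \<le> B\<close> on \<open>'a \<Rightarrow> 'a set\<close> is inclusion of graphs.\<close>

definition maximal_monotone :: "('a::real_inner \<Rightarrow> 'a set) \<Rightarrow> bool" where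
  "maximal_monotone A \<longleftrightarrow>
     monotone_operator A \<and> (\<forall>B. monotone_operator B \<and> A \<le> B \<longrightarrow> B = A)"

definition op_inverse :: "('a \<Rightarrow> 'b set) \<Rightarrow> 'b \<Rightarrow> 'a set" where
  "op_inverse A y = {x. y \<in> A x}"

text \<open>
  The resolvent \<open>(I + \<gamma> A)\<inverse>\<close> as a function. For maximal monotone \<open>A\<close> on a Hilbert
  space and \<open>\<gamma> > 0\<close> the set below is a singleton for every \<open>x\<close> (Minty); in other
  cases the value may be unspecified.
\<close>

definition resolvent :: "real \<Rightarrow> ('a::real_inner \<Rightarrow> 'a set) \<Rightarrow> 'a \<Rightarrow> 'a" where
  "resolvent \<gamma> A x = the_elem (op_inverse (\<lambda>z. {z + \<gamma> *\<^sub>R v | v. v \<in> A z}) x)"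

definition strong_major :: "(nat \<Rightarrow> nat) \<Rightarrow> (nat \<Rightarrow> nat) \<Rightarrow> bool"  (infix "\<le>*" 50) where
  "g \<le>* f \<longleftrightarrow> (\<forall>m n. m \<le> n \<longrightarrow> g m \<le> f n \<and> f m \<le> f n)"

definition monotone_functional :: "(nat \<Rightarrow> (nat \<Rightarrow> nat) \<Rightarrow> nat) \<Rightarrow> bool" where
  "monotone_functional \<phi> \<longleftrightarrow> (\<forall>m n g f. m \<le> n \<and> g \<le>* f \<longrightarrow> \<phi> m g \<le> \<phi> n f)"

definition rate_of_divergence :: "(nat \<Rightarrow> nat) \<Rightarrow> (nat \<Rightarrow> real) \<Rightarrow> bool" where
  "rate_of_divergence \<gamma> a \<longleftrightarrow> (\<forall>k n. (\<Sum>i=0..\<gamma> k + n. a i) \<ge> real k)"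

definition quasi_rate_asymptotic_regularity ::
  "(nat \<Rightarrow> (nat \<Rightarrow> nat) \<Rightarrow> nat) \<Rightarrow> (nat \<Rightarrow> 'a::real_normed_vector) \<Rightarrow>
    ('a \<Rightarrow> 'a) \<Rightarrow> ('a \<Rightarrow> 'a) \<Rightarrow> bool" where
  "quasi_rate_asymptotic_regularity \<Gamma> y T T' \<longleftrightarrow>
     (\<forall>k f. \<exists>n\<le>\<Gamma> k f. \<forall>m\<in>{n..f n}.
        max (norm (T (y m) - y m)) (norm (T' (y m) - y m)) \<le> 1 / (real k + 1))"

definition sigma1 :: "(nat \<Rightarrow> nat) \<Rightarrow> nat \<Rightarrow> nat \<Rightarrow> nat \<Rightarrow> nat" where
  "sigma1 \<Delta> N k n = \<Delta> (n + nat \<lceil>ln (16 * (real N)\<^sup>2 * (real k + 1))\<rceil>) + 1"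

definition w_fun :: "(nat \<Rightarrow> nat) \<Rightarrow> nat \<Rightarrow> nat \<Rightarrow> nat" where
  "w_fun f N m = max (f (24 * N * (m + 1)\<^sup>2)) (24 * N * (m + 1)\<^sup>2)"

definition zeta_bound :: "nat \<Rightarrow> nat \<Rightarrow> (nat \<Rightarrow> nat) \<Rightarrow> nat" where
  "zeta_bound N k f =
     24 * N * (((w_fun f N ^^ (4 * N ^ 4 * (k + 1)\<^sup>2)) 0) + 1)\<^sup>2"

definition Omega_bound ::
  "nat \<Rightarrow> (nat \<Rightarrow> (nat \<Rightarrow> nat) \<Rightarrow> nat) \<Rightarrow> nat \<Rightarrow> (nat \<Rightarrow> nat) \<Rightarrow> nat" where
  "Omega_bound N \<eta> k f = \<eta> (zeta_bound N k (\<lambda>m. f (\<eta> m f))) f"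

text \<open>
  The subtractions are on \<open>nat\<close>. In \<open>g\<close> nothing is truncated as soon as \<open>N\<close> and \<open>R\<close> are
  positive and \<open>t\<close> has no zeros, the latter being forced by \<open>1/R \<le> \<beta> n \<le> t n\<close>.
\<close>

definition mu_bound ::
  "(nat \<Rightarrow> nat) \<Rightarrow> (nat \<Rightarrow> nat) \<Rightarrow> nat \<Rightarrow> nat \<Rightarrow> (nat \<Rightarrow> (nat \<Rightarrow> nat) \<Rightarrow> nat) \<Rightarrow>
    nat \<Rightarrow> (nat \<Rightarrow> nat) \<Rightarrow> nat" where
  "mu_bound \<Delta> t N R \<eta> k f =
     (let k1 = (k + 1)\<^sup>2 - 1;
          k2 = 16 * (k + 1)\<^sup>2 - 1;
          p = (\<lambda>n. f (sigma1 \<Delta> N k1 n));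
          g = (\<lambda>n. 64 * N * R * (k + 1)\<^sup>2 * (p n + 1) * t (p n) - 1)
      in sigma1 \<Delta> N k1 (Omega_bound N \<eta> k2 (\<lambda>n. 2 * g n + 2)))"

end

theory Submission
  imports Defs
begin

text \<open>
  If \<open>x\<close> is an approximate projection of \<open>u\<close> onto the common zeros, firm nonexpansiveness gives
  \<open>(1 + \<alpha>) |y\<^sub>2\<^sub>n\<^sub>+\<^sub>1 - x|\<^sup>2 \<le> (1 - \<alpha>) |y\<^sub>2\<^sub>n - x|\<^sup>2 + 2 \<alpha> \<langle>u - x, y\<^sub>2\<^sub>n\<^sub>+\<^sub>1 - x\<rangle>\<close> up to a small error, and
  the same for the other resolvent, so \<open>|y\<^sub>2\<^sub>n - x|\<^sup>2\<close> shrinks by \<open>exp (- \<Sum> \<alpha>\<^sub>i)\<close> as long as the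
  inner products are small. They are small because the variational inequality at \<open>x\<close> holds against
  all sufficiently good approximate common fixed points, in particular against the \<open>y\<^sub>m\<close> in a
  region of asymptotic regularity. That the resolvents are defined everywhere is Minty's theorem.
\<close>

section \<open>Minimising strongly convex functions and Minty's theorem\<close>

text \<open>Let \<open>s\<close> tend to 0 from the right. This extracts a first-order optimality
  condition from a comparison along a segment.\<close>

lemma nonneg_if_affine_nonneg:
  fixes c D :: real
  assumes "\<And>s. 0 < s \<Longrightarrow> s \<le> 1 \<Longrightarrow> 0 \<le> c + s * D"
  shows "0 \<le> c"
proof (rule tendsto_lowerbound)
  show "((\<lambda>s. c + s * D) \<longlongrightarrow> c) (at_right 0)"
    by (auto intro!: tendsto_eq_intros)
  show "\<forall>\<^sub>F s in at_right 0. 0 \<le> c + s * D"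
    unfolding eventually_at_right_field using assms by (intro exI[of _ 1]) auto
qed simp

text \<open>\<open>C\<close> plays the role of an epigraph, which avoids extended-valued functions.
  Near-minimisers have Cauchy first components by the parallelogram law, so completeness suffices
  and no compactness is called for.\<close>

lemma strongly_convex_attains_min:
  fixes C :: "('b::{real_inner, complete_space} \<times> real) set"
  assumes "closed C" "convex C" "C \<noteq> {}"
    and nonneg: "\<And>z r. (z, r) \<in> C \<Longrightarrow> 0 \<le> r + (norm z)\<^sup>2 / 2"
  obtains z0 r0 where "(z0, r0) \<in> C"
    and "\<And>z r. (z, r) \<in> C \<Longrightarrow> r0 + (norm z0)\<^sup>2 / 2 \<le> r + (norm z)\<^sup>2 / 2"
proof -
  define F :: "'b \<times> real \<Rightarrow> real" where "F = (\<lambda>c. snd c + (norm (fst c))\<^sup>2 / 2)"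
  define I where "I = Inf (F ` C)"
  have bdd: "bdd_below (F ` C)"
    using nonneg by (auto simp: F_def intro!: bdd_belowI[of _ 0])
  have I_le: "I \<le> F c" if "c \<in> C" for c
    unfolding I_def using bdd that by (simp add: cInf_lower)
  have "\<exists>c\<in>C. F c < I + 1 / (real n + 1)" for n
    using cInf_lessD[of "F ` C" "I + 1 / (real n + 1)"] assms(3) by (auto simp: I_def)
  then obtain c where c: "\<And>n. c n \<in> C" "\<And>n. F (c n) < I + 1 / (real n + 1)"
    by metis
  define z where "z n = fst (c n)" for n
  have par: "(norm (z n - z m))\<^sup>2 \<le> 4 * (1 / (real n + 1) + 1 / (real m + 1))" for n m
  proof -
    \<comment> \<open>The midpoint cannot go below the infimum. By the parallelogram law its
      quadratic term falls short of the average by \<open>1/8\<close> of the squared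
      distance.\<close>
    have "(1/2) *\<^sub>R c n + (1/2) *\<^sub>R c m \<in> C"
      using \<open>convex C\<close> c(1) by (simp add: convex_def)
    from I_le[OF this]
    have "I \<le> (F (c n) + F (c m)) / 2 - (norm (z n - z m))\<^sup>2 / 8"
      by (simp add: F_def z_def power2_norm_eq_inner inner_simps inner_commute field_simps)
    with c(2)[of n] c(2)[of m] show ?thesis by argo
  qed
  have "Cauchy z"
  proof (rule metric_CauchyI)
    fix e :: real assume "e > 0"
    obtain M :: nat where M: "8 / e\<^sup>2 < real M" using reals_Archimedean2 by blast
    show "\<exists>M. \<forall>m\<ge>M. \<forall>n\<ge>M. dist (z m) (z n) < e"
    proof (intro exI[of _ M] allI impI)
      fix m n assume mn: "M \<le> m" "M \<le> n"
      have "8 < e\<^sup>2 * (real M + 1)"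
        using M \<open>e > 0\<close> by (simp add: divide_less_eq algebra_simps)
          (smt (verit) zero_le_power2)
      then have M': "8 / (real M + 1) < e\<^sup>2"
        by (simp add: divide_less_eq)
      have "1 / (real m + 1) \<le> 1 / (real M + 1)" "1 / (real n + 1) \<le> 1 / (real M + 1)"
        using mn by (auto intro!: divide_left_mono)
      then have "(norm (z m - z n))\<^sup>2 \<le> 8 / (real M + 1)"
        using par[of m n] by argo
      then have "(norm (z m - z n))\<^sup>2 < e\<^sup>2" using M' by linarith
      then show "dist (z m) (z n) < e"
        using \<open>e > 0\<close> by (simp add: dist_norm power_less_imp_less_base)
    qed
  qed
  then obtain z0 where z0: "z \<longlonglongrightarrow> z0" using Cauchy_convergent convergentD by blast
  have Flim: "(\<lambda>n. F (c n)) \<longlonglongrightarrow> I"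
  proof (rule tendsto_sandwich[where f = "\<lambda>_. I" and h = "\<lambda>n. I + 1 / (real n + 1)"])
    show "(\<lambda>n. I + 1 / (real n + 1)) \<longlonglongrightarrow> I"
      using tendsto_add[OF tendsto_const[of I] LIMSEQ_inverse_real_of_nat]
      by (simp add: inverse_eq_divide add.commute)
  qed (use c I_le in \<open>auto intro!: always_eventually less_imp_le\<close>)
  define r0 where "r0 = I - (norm z0)\<^sup>2 / 2"
  \<comment> \<open>The second components converge too, being the values of \<open>F\<close> minus a
    continuous function of \<open>z n\<close>.\<close>
  have "(\<lambda>n. F (c n) - (norm (z n))\<^sup>2 / 2) \<longlonglongrightarrow> r0"
    unfolding r0_def by (intro tendsto_intros Flim z0) simp
  then have "(\<lambda>n. snd (c n)) \<longlonglongrightarrow> r0" by (simp add: F_def z_def)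
  with z0 have "(\<lambda>n. (fst (c n), snd (c n))) \<longlonglongrightarrow> (z0, r0)"
    unfolding z_def by (rule tendsto_Pair)
  then have "(z0, r0) \<in> C"
    using closed_sequentially[OF \<open>closed C\<close>, of c "(z0, r0)"] c(1) by simp
  then show thesis
  proof (rule that)
    fix z r assume "(z, r) \<in> C"
    from I_le[OF this] show "r0 + (norm z0)\<^sup>2 / 2 \<le> r + (norm z)\<^sup>2 / 2"
      by (simp add: F_def r0_def)
  qed
qed

text \<open>Adding the pair \<open>(a, b)\<close> to the graph keeps it monotone, so maximality says
  that it was there already.\<close>

lemma maximal_monotone_memI:
  assumes "maximal_monotone A"
    and rel: "\<And>x v. v \<in> A x \<Longrightarrow> 0 \<le> (a - x) \<bullet> (b - v)"
  shows "b \<in> A a"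
proof -
  define B where "B = A(a := insert b (A a))"
  have "monotone_operator A" using assms by (simp add: maximal_monotone_def)
  then have "monotone_operator B"
    unfolding monotone_operator_def B_def
    using rel by (auto simp: inner_diff_left inner_diff_right algebra_simps)
  moreover have "A \<le> B" by (auto simp: B_def le_fun_def)
  ultimately have "B = A" using assms by (simp add: maximal_monotone_def)
  then show ?thesis by (metis B_def fun_upd_same insertI1)
qed

text \<open>
  Minty's theorem by Fitzpatrick's function: \<open>C\<close> is the epigraph of
  \<open>(x, v) \<mapsto> SUP (a, b) \<in> G. x \<bullet> b + a \<bullet> v - a \<bullet> b\<close>. If \<open>(x, v)\<close> minimises that function plus
  \<open>(|x|\<^sup>2 + |v|\<^sup>2) / 2\<close>, the optimality condition says that \<open>(-v, -x)\<close> is monotonically related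
  to \<open>G\<close>, with a surplus \<open>|x + v|\<^sup>2\<close> which then has to vanish.
\<close>

lemma maximal_monotone_graph_meets_antidiagonal:
  fixes G :: "('a::{real_inner, complete_space} \<times> 'a) set"
  assumes mono: "\<And>a b c d. (a, b) \<in> G \<Longrightarrow> (c, d) \<in> G \<Longrightarrow> 0 \<le> (a - c) \<bullet> (b - d)"
    and max: "\<And>a b. (\<And>c d. (c, d) \<in> G \<Longrightarrow> 0 \<le> (a - c) \<bullet> (b - d)) \<Longrightarrow> (a, b) \<in> G"
  obtains a where "(a, - a) \<in> G"
proof -
  \<comment> \<open>Pairing with the swapped vector \<open>(b, a)\<close> in the product space shows
    \<open>C\<close> as an intersection of closed half-spaces.\<close>
  define C where "C = (\<Inter>(a, b)\<in>G. {c. fst c \<bullet> (b, a) - a \<bullet> b \<le> snd c})"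
  have C_iff: "((x, v), r) \<in> C \<longleftrightarrow> (\<forall>(a, b)\<in>G. x \<bullet> b + a \<bullet> v - a \<bullet> b \<le> r)" for x v r
    by (auto simp: C_def inner_commute)
  have "closed C"
    unfolding C_def
    by (intro closed_INT ballI) (auto intro!: closed_Collect_le continuous_intros)
  have "convex C"
    unfolding C_def
  proof (intro convex_INT, clarify)
    fix a b :: 'a
    have "{c :: ('a \<times> 'a) \<times> real. fst c \<bullet> (b, a) - a \<bullet> b \<le> snd c}
        = {c. ((b, a), -1) \<bullet> c \<le> a \<bullet> b}"
      by (auto simp: inner_prod_def inner_commute algebra_simps)
    then show "convex {c :: ('a \<times> 'a) \<times> real. fst c \<bullet> (b, a) - a \<bullet> b \<le> snd c}"
      using convex_halfspace_le by metis
  qed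
  have G_C: "((a, b), a \<bullet> b) \<in> C" if "(a, b) \<in> G" for a b
    using mono[OF that] by (auto simp: C_iff inner_simps algebra_simps inner_commute)
  have "G \<noteq> {}" using max by blast
  with G_C have "C \<noteq> {}" by auto
  \<comment> \<open>If \<open>r\<close> were below \<open>x \<bullet> v\<close>, then
    \<open>(x, v)\<close> would be monotonically related to \<open>G\<close>, hence in
    \<open>G\<close>, and its own constraint would give
    \<open>x \<bullet> v \<le> r\<close>.\<close>
  have fitz: "x \<bullet> v \<le> r" if "((x, v), r) \<in> C" for x v r
  proof (rule ccontr)
    assume "\<not> x \<bullet> v \<le> r"
    then have "(x, v) \<in> G"
      using that by (intro max) (fastforce simp: C_iff inner_simps algebra_simps)
    then show False using that \<open>\<not> x \<bullet> v \<le> r\<close> by (force simp: C_iff)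
  qed
  have nonneg: "0 \<le> r + (norm z)\<^sup>2 / 2" if "(z, r) \<in> C" for z r
  proof -
    obtain x v where z: "z = (x, v)" by force
    have "0 \<le> (norm (x + v))\<^sup>2" by simp
    also have "\<dots> = 2 * (x \<bullet> v) + (norm z)\<^sup>2"
      by (simp add: z power2_norm_eq_inner inner_simps inner_commute)
    finally show ?thesis using fitz that z by force
  qed
  obtain z0 r0 where z0: "(z0, r0) \<in> C"
    and min: "\<And>z r. (z, r) \<in> C \<Longrightarrow> r0 + (norm z0)\<^sup>2 / 2 \<le> r + (norm z)\<^sup>2 / 2"
    using strongly_convex_attains_min[OF \<open>closed C\<close> \<open>convex C\<close> \<open>C \<noteq> {}\<close> nonneg] by metis
  obtain x v where xv: "z0 = (x, v)" by force
  have opt: "0 \<le> r - r0 + z0 \<bullet> (z - z0)" if "(z, r) \<in> C" for z r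
  proof (rule nonneg_if_affine_nonneg)
    fix s :: real assume s: "0 < s" "s \<le> 1"
    have "(1 - s) *\<^sub>R (z0, r0) + s *\<^sub>R (z, r) \<in> C"
      using s z0 that \<open>convex C\<close> unfolding convex_alt by (meson less_imp_le)
    then have "(z0 + s *\<^sub>R (z - z0), r0 + s * (r - r0)) \<in> C"
      by (simp add: algebra_simps)
    from min[OF this]
    have "0 \<le> s * ((r - r0 + z0 \<bullet> (z - z0)) + s * ((norm (z - z0))\<^sup>2 / 2))"
      by (simp add: power2_norm_eq_inner inner_simps inner_commute field_simps)
    then show "0 \<le> (r - r0 + z0 \<bullet> (z - z0)) + s * ((norm (z - z0))\<^sup>2 / 2)"
      using s by (simp add: zero_le_mult_iff)
  qed
  \<comment> \<open>Optimality is tested at the points \<open>((a, b), a \<bullet> b)\<close> of the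
    epigraph, and \<open>fitz\<close> bounds \<open>r0\<close> below by
    \<open>x \<bullet> v\<close>, which completes the square.\<close>
  have rel: "(norm (x + v))\<^sup>2 \<le> (- v - a) \<bullet> (- x - b)" if "(a, b) \<in> G" for a b
    using opt[OF G_C[OF that]] fitz[OF z0[unfolded xv]]
    by (simp add: xv power2_norm_eq_inner inner_simps inner_commute algebra_simps)
  have "(- v, - x) \<in> G"
    by (rule max) (use rel in \<open>meson order_trans zero_le_power2\<close>)
  from rel[OF this] this have "(x, - x) \<in> G"
    by (simp add: add_eq_0_iff2)
  then show thesis by (rule that)
qed

text \<open>Translating the domain by \<open>x\<close> and scaling the values by
  \<open>\<gamma>\<close> keeps the graph maximal monotone; a point \<open>(a, - a)\<close> of the
  new graph is exactly a solution of \<open>x = z + \<gamma> v\<close>.\<close>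

theorem minty:
  fixes A :: "'a::{real_inner, complete_space} \<Rightarrow> 'a set"
  assumes A: "maximal_monotone A" and "0 < \<gamma>"
  obtains z v where "v \<in> A z" "x = z + \<gamma> *\<^sub>R v"
proof -
  define G where "G = {(z - x, \<gamma> *\<^sub>R v) | z v. v \<in> A z}"
  have monA: "monotone_operator A" using A by (simp add: maximal_monotone_def)
  obtain a where "(a, - a) \<in> G"
  proof (rule maximal_monotone_graph_meets_antidiagonal)
    fix a b c d assume "(a, b) \<in> G" "(c, d) \<in> G"
    then show "0 \<le> (a - c) \<bullet> (b - d)"
      using monA \<open>0 < \<gamma>\<close>
      by (auto simp: G_def monotone_operator_def scaleR_diff_right[symmetric])
  next
    fix a b assume rel: "\<And>c d. (c, d) \<in> G \<Longrightarrow> 0 \<le> (a - c) \<bullet> (b - d)"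
    have "(1 / \<gamma>) *\<^sub>R b \<in> A (a + x)"
    proof (rule maximal_monotone_memI[OF A])
      fix z v assume "v \<in> A z"
      then have "0 \<le> (a - (z - x)) \<bullet> (b - \<gamma> *\<^sub>R v)"
        by (intro rel) (auto simp: G_def)
      also have "\<dots> = \<gamma> * ((a + x - z) \<bullet> ((1 / \<gamma>) *\<^sub>R b - v))"
        using \<open>0 < \<gamma>\<close> by (simp add: inner_simps algebra_simps)
      finally show "0 \<le> (a + x - z) \<bullet> ((1 / \<gamma>) *\<^sub>R b - v)"
        using \<open>0 < \<gamma>\<close> by (simp add: zero_le_mult_iff)
    qed
    then show "(a, b) \<in> G"
      unfolding G_def mem_Collect_eq using \<open>0 < \<gamma>\<close>
      by (intro exI[of _ "a + x"] exI[of _ "(1 / \<gamma>) *\<^sub>R b"]) simp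
  qed blast
  then obtain z v where "v \<in> A z" "a = z - x" "- a = \<gamma> *\<^sub>R v"
    by (auto simp: G_def)
  moreover from this have "x = z + \<gamma> *\<^sub>R v"
    by (metis add_diff_cancel_left' diff_add_cancel diff_minus_eq_add minus_diff_eq)
  ultimately show thesis by (intro that)
qed

section \<open>Resolvents of maximal monotone operators\<close>

text \<open>Two decompositions of one point satisfy \<open>\<gamma> (v' - v) = - (z' - z)\<close>,
  so monotonicity forces \<open>z' = z\<close>. This makes the set under \<open>the_elem\<close> a
  singleton.\<close>

lemma resolvent_eqI:
  assumes "monotone_operator A" "0 < \<gamma>" "v \<in> A z"
  shows "resolvent \<gamma> A (z + \<gamma> *\<^sub>R v) = z"
proof -
  have "z' = z" if "v' \<in> A z'" "z + \<gamma> *\<^sub>R v = z' + \<gamma> *\<^sub>R v'" for z' v'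
  proof -
    have "0 \<le> (z' - z) \<bullet> (v' - v)"
      using assms that by (auto simp: monotone_operator_def)
    then have "0 \<le> (z' - z) \<bullet> (\<gamma> *\<^sub>R (v' - v))"
      using assms(2) by simp
    also have "\<gamma> *\<^sub>R (v' - v) = - (z' - z)"
      using that(2) by (simp add: algebra_simps)
    finally have "(norm (z' - z))\<^sup>2 \<le> 0"
      by (simp add: power2_norm_eq_inner inner_diff_left inner_diff_right)
    then show ?thesis by simp
  qed
  then have "op_inverse (\<lambda>z. {z + \<gamma> *\<^sub>R v | v. v \<in> A z}) (z + \<gamma> *\<^sub>R v) = {z}"
    using assms(3) by (auto simp: op_inverse_def)
  then show ?thesis by (simp add: resolvent_def)
qed

lemma resolvent_mem:
  fixes A :: "'a::{real_inner, complete_space} \<Rightarrow> 'a set"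
  assumes "maximal_monotone A" "0 < \<gamma>"
  shows "(1 / \<gamma>) *\<^sub>R (x - resolvent \<gamma> A x) \<in> A (resolvent \<gamma> A x)"
proof -
  obtain z v where "v \<in> A z" "x = z + \<gamma> *\<^sub>R v" using minty[OF assms] .
  moreover from this have "resolvent \<gamma> A x = z"
    using assms resolvent_eqI by (auto simp: maximal_monotone_def)
  ultimately show ?thesis using assms(2) by simp
qed

lemma resolvent_zero:
  assumes "maximal_monotone A" "0 < \<gamma>" "q \<in> op_inverse A 0"
  shows "resolvent \<gamma> A q = q"
  using resolvent_eqI[of A \<gamma> 0 q] assms by (simp add: maximal_monotone_def op_inverse_def)

text \<open>Monotonicity at the two resolvent points, multiplied by \<open>\<beta>\<close>. The
  parameters may differ because the iteration uses varying ones while \<open>x\<close> is tested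
  only with \<open>1/R\<close>; for equal ones it is firm nonexpansiveness.\<close>

lemma resolvent_monotone:
  fixes A :: "'a::{real_inner, complete_space} \<Rightarrow> 'a set"
  assumes "maximal_monotone A" "0 < \<beta>" "0 < \<gamma>"
  shows "0 \<le> (resolvent \<beta> A w - resolvent \<gamma> A x) \<bullet>
    ((w - resolvent \<beta> A w) - (\<beta> / \<gamma>) *\<^sub>R (x - resolvent \<gamma> A x))"
    (is "0 \<le> (?z - ?x) \<bullet> _")
proof -
  have "0 \<le> (?z - ?x) \<bullet> ((1 / \<beta>) *\<^sub>R (w - ?z) - (1 / \<gamma>) *\<^sub>R (x - ?x))"
    using assms resolvent_mem[OF assms(1)]
    by (auto simp: maximal_monotone_def monotone_operator_def)
  then have "0 \<le> \<beta> * ((?z - ?x) \<bullet> ((1 / \<beta>) *\<^sub>R (w - ?z) - (1 / \<gamma>) *\<^sub>R (x - ?x)))"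
    using assms(2) by simp
  also have "\<dots> = (?z - ?x) \<bullet> (\<beta> *\<^sub>R ((1 / \<beta>) *\<^sub>R (w - ?z) - (1 / \<gamma>) *\<^sub>R (x - ?x)))"
    by simp
  also have "\<beta> *\<^sub>R ((1 / \<beta>) *\<^sub>R (w - ?z) - (1 / \<gamma>) *\<^sub>R (x - ?x))
      = (w - ?z) - (\<beta> / \<gamma>) *\<^sub>R (x - ?x)"
    using assms(2) by (simp add: scaleR_diff_right)
  finally show ?thesis .
qed

lemma resolvent_nonexpansive:
  fixes A :: "'a::{real_inner, complete_space} \<Rightarrow> 'a set"
  assumes "maximal_monotone A" "0 < \<gamma>"
  shows "norm (resolvent \<gamma> A w - resolvent \<gamma> A x) \<le> norm (w - x)"
proof -
  let ?d = "resolvent \<gamma> A w - resolvent \<gamma> A x"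
  have "?d \<bullet> ?d \<le> ?d \<bullet> (w - x)"
    using resolvent_monotone[OF assms(1) assms(2) assms(2), of w x] assms(2)
    by (simp add: inner_simps inner_commute algebra_simps)
  also have "\<dots> \<le> norm ?d * norm (w - x)" by (rule norm_cauchy_schwarz)
  finally show ?thesis
    by (cases "?d = 0") (auto simp: power2_norm_eq_inner[symmetric] power2_eq_square)
qed

section \<open>Approximate fixed points and approximate projections\<close>

text \<open>\<open>T z\<close> is almost as close to \<open>x\<close> and \<open>y\<close> as
  \<open>z\<close> is. In the identity for the squared distance to a point of a segment the terms in
  \<open>d\<close> squared cancel, and what is left is small with \<open>\<delta>\<close>.\<close>

lemma nonexpansive_convex_comb_displacement:
  fixes T :: "'a::real_inner \<Rightarrow> 'a"
  assumes T: "\<And>a b. norm (T a - T b) \<le> norm (a - b)"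
    and x: "norm (T x - x) \<le> \<delta>" and y: "norm (T y - y) \<le> \<delta>"
    and D: "norm (x - y) \<le> D" and s: "0 \<le> s" "s \<le> 1"
  defines "z \<equiv> (1 - s) *\<^sub>R x + s *\<^sub>R y"
  shows "(norm (T z - z))\<^sup>2 \<le> \<delta>\<^sup>2 + D * \<delta>"
proof -
  define d where "d = norm (x - y)"
  have d: "0 \<le> d" "d \<le> D" using D by (auto simp: d_def)
  have \<delta>: "0 \<le> \<delta>" using x norm_ge_zero order_trans by blast
  have "z - x = s *\<^sub>R (y - x)" "z - y = (1 - s) *\<^sub>R (x - y)"
    by (simp_all add: z_def algebra_simps)
  then have "norm (z - x) = s * d" "norm (z - y) = (1 - s) * d"
    using s by (simp_all add: d_def norm_minus_commute)
  then have "norm (T z - x) \<le> \<delta> + s * d" "norm (T z - y) \<le> \<delta> + (1 - s) * d"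
    using norm_triangle_ineq[of "T z - T x" "T x - x"] T[of z x] x
      norm_triangle_ineq[of "T z - T y" "T y - y"] T[of z y] y by simp_all
  then have sq: "(norm (T z - x))\<^sup>2 \<le> (\<delta> + s * d)\<^sup>2" "(norm (T z - y))\<^sup>2 \<le> (\<delta> + (1 - s) * d)\<^sup>2"
    by (simp_all add: power_mono)
  have "(norm (T z - z))\<^sup>2
      = (1 - s) * (norm (T z - x))\<^sup>2 + s * (norm (T z - y))\<^sup>2 - s * (1 - s) * d\<^sup>2"
    by (simp add: z_def d_def power2_norm_eq_inner inner_simps inner_commute algebra_simps)
  also have "\<dots> \<le> (1 - s) * (\<delta> + s * d)\<^sup>2 + s * (\<delta> + (1 - s) * d)\<^sup>2 - s * (1 - s) * d\<^sup>2"
    using sq s by (intro diff_right_mono add_mono mult_left_mono) auto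
  also have "\<dots> = \<delta>\<^sup>2 + (4 * s * (1 - s)) * (d * \<delta>)"
    by (simp add: power2_eq_square algebra_simps)
  also have "\<dots> \<le> \<delta>\<^sup>2 + 1 * (D * \<delta>)"
  proof (intro add_left_mono mult_mono)
    show "4 * s * (1 - s) \<le> 1"
      using zero_le_power2[of "2 * s - 1"] by (simp add: power2_eq_square algebra_simps)
  qed (use d \<delta> s in auto)
  finally show ?thesis by simp
qed

text \<open>The constant in \<open>w_fun\<close> comes from here: with \<open>D = 2 N\<close> the
  squared displacement is at most \<open>3 N \<delta>\<close>, and \<open>\<delta>\<close> is below
  \<open>1 / (24 N (m + 1)^2)\<close>.\<close>

lemma nonexpansive_convex_comb_tolerance:
  fixes T :: "'a::real_inner \<Rightarrow> 'a"
  assumes T: "\<And>a b. norm (T a - T b) \<le> norm (a - b)"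
    and "0 < N" and xy: "x \<in> cball q (real N)" "y \<in> cball q (real N)"
    and x: "norm (T x - x) \<le> 1 / (real (24 * N * (m + 1)\<^sup>2) + 1)"
    and y: "norm (T y - y) \<le> 1 / (real (24 * N * (m + 1)\<^sup>2) + 1)"
    and s: "0 \<le> s" "s \<le> 1"
  defines "z \<equiv> (1 - s) *\<^sub>R x + s *\<^sub>R y"
  shows "norm (T z - z) \<le> 1 / (real m + 1)"
proof (rule power2_le_imp_le)
  define K where "K = 24 * real N * (real m + 1)\<^sup>2"
  define \<delta> where "\<delta> = 1 / (K + 1)"
  have N: "1 \<le> real N" using \<open>0 < N\<close> by simp
  have "1 \<le> (real m + 1)\<^sup>2" by simp
  then have K: "0 < K" "24 * (real m + 1)\<^sup>2 \<le> K"
    using N by (simp_all add: K_def)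
  have \<delta>: "0 < \<delta>" "\<delta> \<le> 1" "\<delta> * K \<le> 1"
    using K by (simp_all add: \<delta>_def)
  have "norm (x - y) \<le> 2 * real N"
    using xy norm_triangle_ineq4[of "x - q" "y - q"] by (simp add: dist_norm norm_minus_commute)
  then have "(norm (T z - z))\<^sup>2 \<le> \<delta>\<^sup>2 + 2 * real N * \<delta>"
    unfolding z_def
    by (intro nonexpansive_convex_comb_displacement T s)
      (use x y in \<open>simp_all add: \<delta>_def K_def algebra_simps\<close>)
  also have "\<dots> \<le> 3 * real N * \<delta>"
  proof -
    have "\<delta> * \<delta> \<le> real N * \<delta>" using \<delta> N by (intro mult_right_mono) auto
    then show ?thesis by (simp add: power2_eq_square mult.commute)
  qed
  also have "\<dots> \<le> (1 / (real m + 1))\<^sup>2"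
  proof -
    have "8 * (3 * real N * \<delta> * (real m + 1)\<^sup>2) = \<delta> * K" by (simp add: K_def)
    with \<delta>(3) have "3 * real N * \<delta> * (real m + 1)\<^sup>2 \<le> 1" by linarith
    then show ?thesis by (simp add: power_divide pos_le_divide_eq)
  qed
  finally show "(norm (T z - z))\<^sup>2 \<le> (1 / (real m + 1))\<^sup>2" .
qed simp

text \<open>The squared distance is at most \<open>|u - x|^2 - 2 s \<epsilon> + s^2 D^2\<close>, and
  the chosen \<open>s\<close> minimises this bound.\<close>

lemma projection_improve:
  fixes u x y :: "'a::real_inner"
  assumes "0 < \<epsilon>" "0 < D" "norm (y - x) \<le> D" "\<epsilon> \<le> (u - x) \<bullet> (y - x)"
  defines "s \<equiv> \<epsilon> / D\<^sup>2"
  shows "(norm (u - ((1 - s) *\<^sub>R x + s *\<^sub>R y)))\<^sup>2 \<le> (norm (u - x))\<^sup>2 - \<epsilon>\<^sup>2 / D\<^sup>2"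
proof -
  have "0 \<le> s" using assms by simp
  have "u - ((1 - s) *\<^sub>R x + s *\<^sub>R y) = (u - x) - s *\<^sub>R (y - x)"
    by (simp add: algebra_simps)
  then have "(norm (u - ((1 - s) *\<^sub>R x + s *\<^sub>R y)))\<^sup>2
      = (norm (u - x))\<^sup>2 - 2 * s * ((u - x) \<bullet> (y - x)) + s\<^sup>2 * (norm (y - x))\<^sup>2"
    by (simp only: power2_norm_eq_inner)
      (simp add: inner_diff_left inner_diff_right inner_commute power2_eq_square algebra_simps)
  also have "\<dots> \<le> (norm (u - x))\<^sup>2 - 2 * s * \<epsilon> + s\<^sup>2 * D\<^sup>2"
    using assms \<open>0 \<le> s\<close> by (intro add_mono diff_left_mono mult_left_mono power_mono) auto
  also have "\<dots> = (norm (u - x))\<^sup>2 - \<epsilon>\<^sup>2 / D\<^sup>2"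
    using assms by (simp add: s_def field_simps power2_eq_square)
  finally show ?thesis .
qed

lemma w_fun_ge: "m \<le> w_fun f N m" if "0 < N"
proof -
  have "m \<le> (m + 1)\<^sup>2" by (simp add: power2_eq_square)
  also have "\<dots> \<le> 24 * N * (m + 1)\<^sup>2" using that by simp
  finally show ?thesis by (simp add: w_fun_def)
qed

lemma w_fun_iterate_mono:
  assumes "0 < N" "i \<le> j"
  shows "(w_fun f N ^^ i) m \<le> (w_fun f N ^^ j) m"
  by (rule lift_Suc_mono_le[OF _ \<open>i \<le> j\<close>]) (simp add: w_fun_ge[OF \<open>0 < N\<close>])

text \<open>
  Each failure of the variational inequality lets one move from \<open>x\<close> towards the offending \<open>y\<close> and
  decrease \<open>|u - x|\<^sup>2\<close> by \<open>1 / (4 N\<^sup>2 (k + 1)\<^sup>2)\<close>, at the price of relaxing the tolerance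
  \<open>1 / (w(m) + 1)\<close> to \<open>1 / (m + 1)\<close>; so the tolerances run through the iterates of \<open>w\<close> backwards.
\<close>

lemma approximate_projection:
  fixes T T' :: "'a::real_inner \<Rightarrow> 'a"
  assumes T: "\<And>a b. norm (T a - T b) \<le> norm (a - b)" "T q = q"
    and T': "\<And>a b. norm (T' a - T' b) \<le> norm (a - b)" "T' q = q"
    and "0 < N" and u: "2 * norm (u - q) \<le> real N"
  shows "\<exists>n\<le>zeta_bound N k f. \<exists>x\<in>cball q (real N).
    norm (T x - x) \<le> 1 / (real (f n) + 1) \<and> norm (T' x - x) \<le> 1 / (real (f n) + 1) \<and>
    (\<forall>y\<in>cball q (real N). norm (T y - y) \<le> 1 / (real n + 1) \<longrightarrow>
       norm (T' y - y) \<le> 1 / (real n + 1) \<longrightarrow> (u - x) \<bullet> (y - x) \<le> 1 / (real k + 1))"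
    (is "?goal")
proof (rule ccontr)
  assume neg: "\<not> ?goal"
  \<comment> \<open>\<open>E\<close> improvements by \<open>\<theta>\<close> amount to
    \<open>N^2\<close>, more than the \<open>N^2 / 4\<close> available at the start.\<close>
  define E where "E = 4 * N ^ 4 * (k + 1)\<^sup>2"
  define W where "W j = (w_fun f N ^^ j) 0" for j
  define \<theta> where "\<theta> = (1 / (real k + 1))\<^sup>2 / (2 * real N)\<^sup>2"
  have N: "1 \<le> real N" using \<open>0 < N\<close> by simp
  have "\<exists>x\<in>cball q (real N). norm (T x - x) \<le> 1 / (real (W (E - j)) + 1) \<and>
      norm (T' x - x) \<le> 1 / (real (W (E - j)) + 1) \<and>
      (norm (u - x))\<^sup>2 \<le> (real N)\<^sup>2 / 4 - real j * \<theta>" if "j \<le> E" for j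
    using that
  proof (induction j)
    \<comment> \<open>The point \<open>q\<close> is fixed exactly, so it meets even the sharpest
      tolerance, that of index \<open>E\<close>.\<close>
    case 0
    have "(norm (u - q))\<^sup>2 \<le> (real N / 2)\<^sup>2" using u by (intro power_mono) auto
    then show ?case
      using T T' by (intro bexI[of _ q]) (auto simp: power_divide)
  next
    case (Suc j)
    then obtain x where x: "x \<in> cball q (real N)"
      "norm (T x - x) \<le> 1 / (real (W (E - j)) + 1)"
      "norm (T' x - x) \<le> 1 / (real (W (E - j)) + 1)"
      "(norm (u - x))\<^sup>2 \<le> (real N)\<^sup>2 / 4 - real j * \<theta>"
      by auto
    \<comment> \<open>\<open>m\<close> is the tolerance to be kept after the move, \<open>n\<close>
      the one required of \<open>y\<close>. As \<open>w(m)\<close> dominates \<open>f n\<close> and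
      \<open>n\<close>, the point \<open>x\<close> is a candidate in the negated goal and is also
      good enough to be combined with \<open>y\<close>.\<close>
    define m where "m = W (E - Suc j)"
    define n where "n = 24 * N * (m + 1)\<^sup>2"
    have "E - j = Suc (E - Suc j)" using Suc.prems by simp
    then have Wj: "W (E - j) = w_fun f N m" by (simp add: W_def m_def)
    then have fn: "f n \<le> W (E - j)" and nW: "n \<le> W (E - j)"
      by (simp_all add: w_fun_def n_def)
    have "m \<le> W E" unfolding m_def W_def by (rule w_fun_iterate_mono[OF \<open>0 < N\<close>]) simp
    then have n_le: "n \<le> zeta_bound N k f"
      by (simp add: n_def zeta_bound_def E_def W_def power_mono)
    have frac: "1 / (real (W (E - j)) + 1) \<le> 1 / (real (f n) + 1)"
      "1 / (real (W (E - j)) + 1) \<le> 1 / (real n + 1)"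
      using fn nW by (auto intro!: divide_left_mono)
    have "norm (T x - x) \<le> 1 / (real (f n) + 1)" "norm (T' x - x) \<le> 1 / (real (f n) + 1)"
      using x(2,3) frac by linarith+
    with neg n_le x(1) obtain y where y: "y \<in> cball q (real N)"
      "norm (T y - y) \<le> 1 / (real n + 1)" "norm (T' y - y) \<le> 1 / (real n + 1)"
      "1 / (real k + 1) < (u - x) \<bullet> (y - x)"
      by (meson not_le)
    define s where "s = (1 / (real k + 1)) / (2 * real N)\<^sup>2"
    define z where "z = (1 - s) *\<^sub>R x + s *\<^sub>R y"
    have "1 \<le> (2 * real N)\<^sup>2" using N by (intro one_le_power) simp
    moreover have "1 / (real k + 1) \<le> 1" by simp
    ultimately have "1 / (real k + 1) \<le> (2 * real N)\<^sup>2" by linarith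
    then have s: "0 \<le> s" "s \<le> 1"
      using N unfolding s_def by (simp, subst divide_le_eq_1_pos, auto)
    have "norm (y - x) \<le> 2 * real N"
      using x(1) y(1) norm_triangle_ineq4[of "y - q" "x - q"]
      by (simp add: dist_norm norm_minus_commute)
    then have "(norm (u - z))\<^sup>2 \<le> (norm (u - x))\<^sup>2 - \<theta>"
      unfolding z_def s_def \<theta>_def using N y(4) by (intro projection_improve) auto
    also have "\<dots> \<le> (real N)\<^sup>2 / 4 - real (Suc j) * \<theta>"
      using x(4) by (simp add: algebra_simps)
    finally have 1: "(norm (u - z))\<^sup>2 \<le> (real N)\<^sup>2 / 4 - real (Suc j) * \<theta>" .
    have 2: "z \<in> cball q (real N)"
      unfolding z_def using x(1) y(1) s convex_cball[of q "real N"] by (simp add: convex_alt)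
    have 3: "norm (T z - z) \<le> 1 / (real m + 1)" "norm (T' z - z) \<le> 1 / (real m + 1)"
      unfolding z_def using x y frac s \<open>0 < N\<close> n_def
      by (auto intro!: nonexpansive_convex_comb_tolerance[of _ N _ q] T T' elim: order_trans)
    from 1 2 3 show ?case unfolding m_def by blast
  qed
  from this[of E] obtain x where "(norm (u - x))\<^sup>2 \<le> (real N)\<^sup>2 / 4 - real E * \<theta>" by auto
  also have "real E * \<theta> = (real N)\<^sup>2"
  proof -
    define a b where "a = (real k + 1)\<^sup>2" and "b = (2 * real N)\<^sup>2"
    have "real E = b * (real N)\<^sup>2 * a"
      by (simp add: E_def a_def b_def power_mult_distrib flip: power_add)
    moreover have "\<theta> = 1 / (a * b)" by (simp add: \<theta>_def a_def b_def power_divide)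
    moreover have "0 < a" "0 < b" using N by (simp_all add: a_def b_def)
    ultimately show ?thesis by simp
  qed
  also have "(real N)\<^sup>2 / 4 - (real N)\<^sup>2 < 0" using N by simp
  finally have "(norm (u - x))\<^sup>2 < 0" .
  then show False by simp
qed

text \<open>The accuracy \<open>n0\<close> demanded of competitors is handed to
  \<open>\<eta>\<close>, which yields the window \<open>[n, f n]\<close>. Since \<open>n\<close> is
  found only after \<open>x\<close>, the projection is taken for
  \<open>\<lambda>m. f (\<eta> m f)\<close>, which dominates \<open>f n\<close> at
  \<open>n0\<close>.\<close>

lemma approximate_projection_along_sequence:
  fixes T T' :: "'a::real_inner \<Rightarrow> 'a"
  assumes T: "\<And>a b. norm (T a - T b) \<le> norm (a - b)" "T q = q"
    and T': "\<And>a b. norm (T' a - T' b) \<le> norm (a - b)" "T' q = q"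
    and "0 < N" and u: "2 * norm (u - q) \<le> real N"
    and y: "\<And>m. y m \<in> cball q (real N)"
    and "monotone_functional \<eta>" "quasi_rate_asymptotic_regularity \<eta> y T T'" "mono f"
  shows "\<exists>n\<le>Omega_bound N \<eta> k f. \<exists>x\<in>cball q (real N).
    norm (T x - x) \<le> 1 / (real (f n) + 1) \<and> norm (T' x - x) \<le> 1 / (real (f n) + 1) \<and>
    (\<forall>m\<in>{n..f n}. (u - x) \<bullet> (y m - x) \<le> 1 / (real k + 1))"
proof -
  let ?f = "\<lambda>m. f (\<eta> m f)"
  obtain n0 x where n0: "n0 \<le> zeta_bound N k ?f" and x: "x \<in> cball q (real N)"
    "norm (T x - x) \<le> 1 / (real (?f n0) + 1)" "norm (T' x - x) \<le> 1 / (real (?f n0) + 1)"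
    "\<And>y. \<lbrakk>y \<in> cball q (real N); norm (T y - y) \<le> 1 / (real n0 + 1);
       norm (T' y - y) \<le> 1 / (real n0 + 1)\<rbrakk> \<Longrightarrow> (u - x) \<bullet> (y - x) \<le> 1 / (real k + 1)"
    using approximate_projection[OF T T' \<open>0 < N\<close> u, of k ?f] by blast
  obtain n where n: "n \<le> \<eta> n0 f"
    and reg: "\<And>m. m \<in> {n..f n} \<Longrightarrow>
      max (norm (T (y m) - y m)) (norm (T' (y m) - y m)) \<le> 1 / (real n0 + 1)"
    using assms(9) unfolding quasi_rate_asymptotic_regularity_def by meson
  have "f \<le>* f" using \<open>mono f\<close> by (simp add: strong_major_def monoD)
  then have "\<eta> n0 f \<le> Omega_bound N \<eta> k f"
    using \<open>monotone_functional \<eta>\<close> n0 by (simp add: monotone_functional_def Omega_bound_def)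
  moreover have "1 / (real (?f n0) + 1) \<le> 1 / (real (f n) + 1)"
    using n \<open>mono f\<close> by (auto intro!: divide_left_mono simp: monoD)
  moreover have "(u - x) \<bullet> (y m - x) \<le> 1 / (real k + 1)" if "m \<in> {n..f n}" for m
    using x(4)[OF y] reg[OF that] by simp
  ultimately show ?thesis
    using n x by (intro exI[of _ n] conjI bexI[of _ x]) auto
qed

section \<open>One anchored resolvent step and the resulting recursion\<close>

text \<open>Subtracting \<open>\<epsilon>\<close> from both squared distances absorbs the inner
  product term, so only the error from \<open>x\<close> not being fixed remains. Truncation at 0
  allows the factor \<open>1 + a\<close> on the left to be dropped.\<close>

lemma resolvent_halpern_step:
  fixes A :: "'a::{real_inner, complete_space} \<Rightarrow> 'a set"
  assumes A: "maximal_monotone A" "0 < \<beta>" "0 < \<gamma>" and a: "0 < a" "a < 1"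
    and w: "w = a *\<^sub>R u + (1 - a) *\<^sub>R y" and z: "z = resolvent \<beta> A w"
    and \<delta>: "norm (resolvent \<gamma> A x - x) \<le> \<delta>"
    and D: "norm (z - resolvent \<gamma> A x) \<le> D" "norm (w - z) \<le> D"
    and M: "\<beta> / \<gamma> + 1 \<le> M" and \<epsilon>: "(u - x) \<bullet> (z - x) \<le> \<epsilon>"
  shows "max 0 ((norm (z - x))\<^sup>2 - \<epsilon>) \<le> (1 - a) * max 0 ((norm (y - x))\<^sup>2 - \<epsilon>) + 2 * M * D * \<delta>"
proof -
  define x' where "x' = resolvent \<gamma> A x"
  define P where "P = max 0 ((norm (y - x))\<^sup>2 - \<epsilon>)"
  have nonneg: "0 \<le> \<delta>" "0 \<le> D" "0 < \<beta> / \<gamma>"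
    using \<delta> D A norm_ge_zero order_trans by (blast, blast, simp)
  have "0 \<le> (z - x') \<bullet> ((w - z) - (\<beta> / \<gamma>) *\<^sub>R (x - x'))"
    unfolding z x'_def by (rule resolvent_monotone[OF A])
  \<comment> \<open>The part that would remain for a fixed \<open>x\<close> is separated from two
    errors, each with a factor \<open>x - x'\<close>.\<close>
  also have "\<dots> = (z - x) \<bullet> (w - x) - (norm (z - x))\<^sup>2 + (x - x') \<bullet> (w - z)
      + (\<beta> / \<gamma>) * ((z - x') \<bullet> (x' - x))"
    by (simp add: power2_norm_eq_inner inner_simps inner_commute algebra_simps)
  also have "\<dots> \<le> (z - x) \<bullet> (w - x) - (norm (z - x))\<^sup>2 + \<delta> * D + (\<beta> / \<gamma>) * (D * \<delta>)"
  proof -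
    have "(x - x') \<bullet> (w - z) \<le> norm (x - x') * norm (w - z)" by (rule norm_cauchy_schwarz)
    also have "\<dots> \<le> \<delta> * D"
      using \<delta> D nonneg by (intro mult_mono) (auto simp: x'_def norm_minus_commute)
    finally have 1: "(x - x') \<bullet> (w - z) \<le> \<delta> * D" .
    have "(z - x') \<bullet> (x' - x) \<le> norm (z - x') * norm (x' - x)" by (rule norm_cauchy_schwarz)
    also have "\<dots> \<le> D * \<delta>"
      using \<delta> D nonneg by (intro mult_mono) (auto simp: x'_def)
    finally have "(\<beta> / \<gamma>) * ((z - x') \<bullet> (x' - x)) \<le> (\<beta> / \<gamma>) * (D * \<delta>)"
      using nonneg by (intro mult_left_mono) auto
    with 1 show ?thesis by linarith
  qed
  also have "\<dots> = (z - x) \<bullet> (w - x) - (norm (z - x))\<^sup>2 + (\<beta> / \<gamma> + 1) * (D * \<delta>)"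
    by (simp add: algebra_simps)
  also have "\<dots> \<le> (z - x) \<bullet> (w - x) - (norm (z - x))\<^sup>2 + M * (D * \<delta>)"
    using M nonneg by (intro add_left_mono mult_right_mono) auto
  finally have 1: "(norm (z - x))\<^sup>2 \<le> (z - x) \<bullet> (w - x) + M * (D * \<delta>)" by simp
  have "w - x = a *\<^sub>R (u - x) + (1 - a) *\<^sub>R (y - x)"
    by (simp add: w algebra_simps)
  then have "(z - x) \<bullet> (w - x) = a * ((u - x) \<bullet> (z - x)) + (1 - a) * ((y - x) \<bullet> (z - x))"
    by (simp add: inner_add_right inner_commute)
  also have "\<dots> \<le> a * \<epsilon> + (1 - a) * (((norm (y - x))\<^sup>2 + (norm (z - x))\<^sup>2) / 2)"
  proof (intro add_mono mult_left_mono)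
    have "0 \<le> (norm ((y - x) - (z - x)))\<^sup>2" by simp
    also have "\<dots> = (norm (y - x))\<^sup>2 + (norm (z - x))\<^sup>2 - 2 * ((y - x) \<bullet> (z - x))"
      unfolding power2_norm_eq_inner
      by (simp only: inner_diff_left[of "y - x"] inner_diff_right[of _ "y - x"])
        (simp add: inner_commute)
    finally show "(y - x) \<bullet> (z - x) \<le> ((norm (y - x))\<^sup>2 + (norm (z - x))\<^sup>2) / 2" by simp
  qed (use a \<epsilon> in auto)
  finally have "(1 + a) * ((norm (z - x))\<^sup>2 - \<epsilon>)
      \<le> (1 - a) * ((norm (y - x))\<^sup>2 - \<epsilon>) + 2 * M * D * \<delta>"
    using 1 by (simp add: field_simps)
  also have "\<dots> \<le> (1 - a) * P + 2 * M * D * \<delta>"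
    using a by (simp add: P_def)
  finally have 2: "(1 + a) * ((norm (z - x))\<^sup>2 - \<epsilon>) \<le> (1 - a) * P + 2 * M * D * \<delta>" .
  have "1 \<le> M" using M nonneg by linarith
  then have 3: "0 \<le> (1 - a) * P + 2 * M * D * \<delta>"
    using a nonneg by (simp add: P_def)
  have "(norm (z - x))\<^sup>2 - \<epsilon> \<le> (1 - a) * P + 2 * M * D * \<delta>"
  proof (cases "0 \<le> (norm (z - x))\<^sup>2 - \<epsilon>")
    case True
    then have "1 * ((norm (z - x))\<^sup>2 - \<epsilon>) \<le> (1 + a) * ((norm (z - x))\<^sup>2 - \<epsilon>)"
      using a by (intro mult_right_mono) auto
    with 2 show ?thesis by simp
  qed (use 3 in linarith)
  with 3 show ?thesis by (simp add: P_def)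
qed

text \<open>Bounding \<open>1 - c\<close> by \<open>exp (- c)\<close> on the main term turns the
  product into an exponential of a sum; on the errors \<open>1 - c \<le> 1\<close> is enough, so
  they merely add up.\<close>

lemma contraction_recursion_bound:
  fixes P c :: "nat \<Rightarrow> real"
  assumes "n \<le> m" and "\<And>i. 0 \<le> P i" "\<And>i. c i \<in> {0<..<1}" "0 \<le> e"
    and step: "\<And>i. n \<le> i \<Longrightarrow> i < m \<Longrightarrow> P (Suc i) \<le> (1 - c i) * P i + e"
  shows "P m \<le> exp (- (\<Sum>i=n..<m. c i)) * P n + real (m - n) * e"
  using \<open>n \<le> m\<close> step
proof (induction m rule: dec_induct)
  case (step m)
  have c: "0 \<le> 1 - c m" "1 - c m \<le> exp (- c m)" "1 - c m \<le> 1"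
    using assms(3)[of m] exp_ge_add_one_self[of "- c m"] by auto
  have IH: "P m \<le> exp (- (\<Sum>i=n..<m. c i)) * P n + real (m - n) * e"
    using step by simp
  have "P (Suc m) \<le> (1 - c m) * P m + e" using step by simp
  also have "\<dots> \<le> (1 - c m) * (exp (- (\<Sum>i=n..<m. c i)) * P n + real (m - n) * e) + e"
    using c IH by (intro add_right_mono mult_left_mono) auto
  also have "\<dots> = (1 - c m) * (exp (- (\<Sum>i=n..<m. c i)) * P n)
      + (1 - c m) * (real (m - n) * e) + e"
    by (simp add: algebra_simps)
  also have "\<dots> \<le> exp (- c m) * (exp (- (\<Sum>i=n..<m. c i)) * P n) + 1 * (real (m - n) * e) + e"
    using c assms(2)[of n] \<open>0 \<le> e\<close> by (intro add_mono mult_right_mono) auto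
  also have "\<dots> = exp (- (\<Sum>i=n..<Suc m. c i)) * P n + real (Suc m - n) * e"
    using step(1) by (simp add: exp_add[symmetric] Suc_diff_le algebra_simps
      flip: mult.assoc)
  finally show ?case .
qed simp

text \<open>The first \<open>n\<close> terms contribute at most \<open>n\<close>, so asking for a
  total of \<open>n + l\<close> leaves \<open>l\<close> for the tail. This explains the argument of
  \<open>\<Delta>\<close> in \<open>sigma1\<close>.\<close>

lemma rate_of_divergence_tail:
  fixes c :: "nat \<Rightarrow> real"
  assumes \<Delta>: "rate_of_divergence \<Delta> c" and c: "\<And>i. c i \<in> {0<..<1}"
    and m: "\<Delta> (n + l) + 1 \<le> m"
  shows "n \<le> m" and "real l \<le> (\<Sum>i=n..<m. c i)"
proof -
  have le: "(\<Sum>i=0..<j. c i) \<le> real j" for j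
    using sum_bounded_above[of "{0..<j}" c 1] c by (auto intro: less_imp_le)
  \<comment> \<open>The rate includes the index \<open>\<Delta> (n + l)\<close> whereas the range
    here is half-open; hence the \<open>+ 1\<close>.\<close>
  obtain d where d: "m = Suc (\<Delta> (n + l) + d)"
    using m by (metis add.commute add_Suc_right le_Suc_ex plus_1_eq_Suc)
  have "real (n + l) \<le> (\<Sum>i=0..\<Delta> (n + l) + d. c i)"
    using \<Delta> unfolding rate_of_divergence_def by blast
  also have "\<dots> = (\<Sum>i=0..<m. c i)"
    by (simp add: d atLeastLessThanSuc_atLeastAtMost)
  finally have *: "real (n + l) \<le> (\<Sum>i=0..<m. c i)" .
  with le[of m] show "n \<le> m" by linarith
  then have "(\<Sum>i=0..<m. c i) = (\<Sum>i=0..<n. c i) + (\<Sum>i=n..<m. c i)"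
    by (simp add: sum.atLeastLessThan_concat)
  with * le[of n] show "real l \<le> (\<Sum>i=n..<m. c i)" by simp
qed

lemma norm_diff_cball_le:
  fixes a b :: "'a::real_normed_vector"
  assumes "a \<in> cball q r" "b \<in> cball q r"
  shows "norm (a - b) \<le> 2 * r"
  using assms norm_triangle_ineq4[of "a - q" "b - q"] by (simp add: dist_norm norm_minus_commute)

lemma resolvent_in_cball:
  fixes A :: "'a::{real_inner, complete_space} \<Rightarrow> 'a set"
  assumes "maximal_monotone A" "0 < \<gamma>" "q \<in> op_inverse A 0" "w \<in> cball q r"
  shows "resolvent \<gamma> A w \<in> cball q r"
  using resolvent_nonexpansive[OF assms(1,2), of w q] resolvent_zero[OF assms(1-3)] assms(4)
  by (simp add: dist_norm norm_minus_commute)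

text \<open>The previous step with \<open>D = 2 r\<close>, the diameter of the invariant ball, and
  \<open>M = 2 b / \<gamma>\<close>, where \<open>\<beta> / \<gamma> \<ge> 1\<close> absorbs the
  summand 1. Together they produce the factor 8.\<close>

lemma resolvent_halpern_step_cball:
  fixes A :: "'a::{real_inner, complete_space} \<Rightarrow> 'a set"
  assumes A: "maximal_monotone A" "0 < \<gamma>" "\<gamma> \<le> \<beta>" "\<beta> \<le> b" and q: "q \<in> op_inverse A 0"
    and a: "a \<in> {0<..<1}"
    and ball: "u \<in> cball q r" "y \<in> cball q r" "x \<in> cball q r"
    and z: "z = resolvent \<beta> A (a *\<^sub>R u + (1 - a) *\<^sub>R y)"
    and \<delta>: "norm (resolvent \<gamma> A x - x) \<le> \<delta>"
    and \<epsilon>: "(u - x) \<bullet> (z - x) \<le> \<epsilon>"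
  shows "max 0 ((norm (z - x))\<^sup>2 - \<epsilon>)
    \<le> (1 - a) * max 0 ((norm (y - x))\<^sup>2 - \<epsilon>) + 8 * (b / \<gamma>) * r * \<delta>"
proof -
  let ?w = "a *\<^sub>R u + (1 - a) *\<^sub>R y"
  have "0 < \<beta>" using A by linarith
  have "?w = (1 - a) *\<^sub>R y + a *\<^sub>R u" by simp
  then have w: "?w \<in> cball q r"
    using ball a convex_cball[of q r] unfolding convex_alt
    by (metis greaterThanLessThan_iff less_imp_le)
  have z': "z \<in> cball q r"
    unfolding z by (rule resolvent_in_cball[OF A(1) \<open>0 < \<beta>\<close> q w])
  have "\<beta> / \<gamma> + 1 \<le> 2 * (b / \<gamma>)"
  proof -
    have "\<beta> / \<gamma> \<le> b / \<gamma>" "1 \<le> \<beta> / \<gamma>" using A by (simp_all add: divide_right_mono)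
    then show ?thesis using A(4) by linarith
  qed
  then have "max 0 ((norm (z - x))\<^sup>2 - \<epsilon>)
      \<le> (1 - a) * max 0 ((norm (y - x))\<^sup>2 - \<epsilon>) + 2 * (2 * (b / \<gamma>)) * (2 * r) * \<delta>"
    using a w z' resolvent_in_cball[OF A(1,2) q ball(3)]
    by (intro resolvent_halpern_step[OF A(1) \<open>0 < \<beta>\<close> A(2) _ _ refl z \<delta> _ _ _ \<epsilon>])
      (auto intro!: norm_diff_cball_le simp del: mem_cball)
  then show "max 0 ((norm (z - x))\<^sup>2 - \<epsilon>)
      \<le> (1 - a) * max 0 ((norm (y - x))\<^sup>2 - \<epsilon>) + 8 * (b / \<gamma>) * r * \<delta>"
    by simp
qed

section \<open>Combining projection and recursion with explicit bounds\<close>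

theorem theorem3p2:
  fixes A B :: "'a::{real_inner, complete_space} \<Rightarrow> 'a set"
    and x0 u q :: 'a
    and y :: "nat \<Rightarrow> 'a"
    and \<alpha> lam \<beta> \<mu> :: "nat \<Rightarrow> real"
    and N R :: nat
    and \<Delta> t :: "nat \<Rightarrow> nat"
    and \<eta> :: "nat \<Rightarrow> (nat \<Rightarrow> nat) \<Rightarrow> nat"
  assumes "maximal_monotone A" and "maximal_monotone B"
    and "op_inverse A 0 \<inter> op_inverse B 0 \<noteq> {}"
    and "\<And>n. \<alpha> n \<in> {0<..<1}" and "\<And>n. lam n \<in> {0<..<1}"
    and "\<And>n. \<beta> n > 0" and "\<And>n. \<mu> n > 0"
    and "y 0 = x0"
    and "\<And>n. y (2 * n + 1) =
           resolvent (\<beta> n) A (\<alpha> n *\<^sub>R u + (1 - \<alpha> n) *\<^sub>R y (2 * n))"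
    and "\<And>n. y (2 * n + 2) =
           resolvent (\<mu> n) B (lam n *\<^sub>R u + (1 - lam n) *\<^sub>R y (2 * n + 1))"
    and "N \<noteq> 0"
    and "q \<in> op_inverse A 0 \<inter> op_inverse B 0"
    and "real N \<ge> Max {2 * norm (u - q), norm (x0 - q), norm q}"
    and "R \<noteq> 0" and "mono \<Delta>" and "mono t"
    and "rate_of_divergence \<Delta> \<alpha> \<or> rate_of_divergence \<Delta> lam"
    and "\<And>n. min (\<beta> n) (\<mu> n) \<ge> 1 / real R"
    and "\<And>n. max (\<beta> n) (\<mu> n) \<le> real (t n)"
    and "monotone_functional \<eta>"
    and "quasi_rate_asymptotic_regularity \<eta> y (resolvent (1 / real R) A) (resolvent (1 / real R) B)"
  shows "\<forall>k (f :: nat \<Rightarrow> nat). mono f \<longrightarrow>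
           (\<exists>n \<le> mu_bound \<Delta> t N R \<eta> k f. \<exists>x \<in> cball q (real N).
              \<forall>m\<in>{n..f n}.
                norm (y (2 * m) - x) \<le> 1 / (real k + 1) \<and>
                norm (resolvent (1 / real R) A x - x) \<le> 1 / (real k + 1) \<and>
                norm (resolvent (1 / real R) B x - x) \<le> 1 / (real k + 1))"
proof (intro allI impI)
  fix k :: nat and f :: "nat \<Rightarrow> nat"
  assume "mono f"
  let ?B = "cball q (real N)"
  let ?JA = "resolvent (1 / real R) A" and ?JB = "resolvent (1 / real R) B"
  have R: "0 < 1 / real R" "0 < R" using \<open>R \<noteq> 0\<close> by simp_all
  have "0 < N" using \<open>N \<noteq> 0\<close> by simp
  have qA: "q \<in> op_inverse A 0" and qB: "q \<in> op_inverse B 0" using assms(12) by auto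
  have uq: "2 * norm (u - q) \<le> real N" and x0: "norm (x0 - q) \<le> real N"
    using assms(13) by simp_all
  have "norm (u - q) \<le> real N" using uq norm_ge_zero[of "u - q"] by linarith
  then have u: "u \<in> ?B" by (simp add: dist_norm norm_minus_commute)
  have \<beta>: "1 / real R \<le> \<beta> n" "\<beta> n \<le> real (t n)"
    and \<mu>: "1 / real R \<le> \<mu> n" "\<mu> n \<le> real (t n)" for n
    using assms(18)[of n] assms(19)[of n] by simp_all
  have t: "0 < t n" for n
    using \<beta>[of n] R by (metis gr0I leD less_le_trans of_nat_0)

  have comb: "a *\<^sub>R u + (1 - a) *\<^sub>R z \<in> ?B" if "a \<in> {0<..<1}" "z \<in> ?B" for a z
    using convexD[OF convex_cball u that(2), of a "1 - a"] that(1) by simp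
  have odd: "y (2 * n + 1) \<in> ?B" if "y (2 * n) \<in> ?B" for n
    unfolding assms(9) using assms(4,6) that
    by (intro resolvent_in_cball[OF assms(1) _ qA] comb)
  have even: "y (2 * n) \<in> ?B" for n
  proof (induction n)
    case 0
    show ?case using x0 assms(8) by (simp add: dist_norm norm_minus_commute)
  next
    case (Suc n)
    have "y (2 * n + 2) \<in> ?B"
      unfolding assms(10) using assms(5,7) odd[OF Suc]
      by (intro resolvent_in_cball[OF assms(2) _ qB] comb)
    then show ?case by simp
  qed
  have y: "y m \<in> ?B" for m
  proof (cases "Parity.even m")
    case True
    then show ?thesis using even by (metis evenE)
  next
    case False
    then show ?thesis using odd even by (metis oddE)
  qed

  define k1 where "k1 = (k + 1)\<^sup>2 - 1"
  define k2 where "k2 = 16 * (k + 1)\<^sup>2 - 1"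
  define p where "p = (\<lambda>n. f (sigma1 \<Delta> N k1 n))"
  define g where "g = (\<lambda>n. 64 * N * R * (k + 1)\<^sup>2 * (p n + 1) * t (p n) - 1)"
  define h where "h = (\<lambda>n. 2 * g n + 2)"
  \<comment> \<open>The goal for squared distances is \<open>1 / K\<close>; the shifts by 1 in
    \<open>k1\<close> and \<open>k2\<close> make their tolerances exactly \<open>1 / K\<close> and
    \<open>1 / (16 K)\<close>.\<close>
  define K where "K = (real k + 1)\<^sup>2"
  have mu: "mu_bound \<Delta> t N R \<eta> k f = sigma1 \<Delta> N k1 (Omega_bound N \<eta> k2 h)"
    by (simp add: mu_bound_def Let_def k1_def k2_def p_def g_def h_def)
  have K1: "real k1 + 1 = K" and K2: "real k2 + 1 = 16 * K" and "real k + 1 \<le> K"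
    by (simp_all add: k1_def k2_def K_def of_nat_diff power2_eq_square algebra_simps)
  then have K: "1 \<le> K" by linarith
  have \<sigma>: "mono (sigma1 \<Delta> N k1)"
    using \<open>mono \<Delta>\<close> by (auto simp: sigma1_def mono_def)
  then have p: "mono p" using \<open>mono f\<close> by (auto simp: p_def mono_def)
  have "mono g"
  proof (rule monoI)
    fix a b :: nat assume "a \<le> b"
    then have "p a \<le> p b" "t (p a) \<le> t (p b)"
      using p \<open>mono t\<close> by (simp_all add: monoD)
    then show "g a \<le> g b"
      unfolding g_def by (intro diff_le_mono mult_le_mono) auto
  qed
  then have "mono h" by (auto simp: h_def mono_def)
  \<comment> \<open>Positivity of \<open>t\<close> rules out truncation in \<open>g\<close>, so
    \<open>2 g + 2\<close> cancels the subtracted 1.\<close>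
  have h: "h n = 128 * N * R * (k + 1)\<^sup>2 * (p n + 1) * t (p n)" for n
  proof -
    define Q where "Q = 64 * N * R * (k + 1)\<^sup>2 * (p n + 1) * t (p n)"
    have "0 < Q" using R \<open>0 < N\<close> t[of "p n"] by (simp add: Q_def)
    moreover have "h n = 2 * (Q - 1) + 2" unfolding h_def g_def Q_def by (rule refl)
    ultimately have "h n = 2 * Q" by simp
    then show ?thesis by (simp add: Q_def)
  qed

  obtain n1 x where n1: "n1 \<le> Omega_bound N \<eta> k2 h" and x: "x \<in> ?B"
    "norm (?JA x - x) \<le> 1 / (real (h n1) + 1)" "norm (?JB x - x) \<le> 1 / (real (h n1) + 1)"
    and proj: "\<And>m. m \<in> {n1..h n1} \<Longrightarrow> (u - x) \<bullet> (y m - x) \<le> 1 / (real k2 + 1)"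
    using approximate_projection_along_sequence[of ?JA q ?JB N u y \<eta> h k2]
      resolvent_nonexpansive[OF assms(1) R(1)] resolvent_zero[OF assms(1) R(1) qA]
      resolvent_nonexpansive[OF assms(2) R(1)] resolvent_zero[OF assms(2) R(1) qB]
      \<open>0 < N\<close> uq y assms(20,21) \<open>mono h\<close> by blast
  \<comment> \<open>The window to be controlled is \<open>[n, P]\<close>. Since
    \<open>p n1 = P\<close>, the value \<open>h n1\<close> was already computed from its right
    end.\<close>
  define n where "n = sigma1 \<Delta> N k1 n1"
  define P where "P = f n"
  define \<delta> where "\<delta> = 1 / (real (h n1) + 1)"
  define \<epsilon> where "\<epsilon> = 1 / (16 * K)"
  have pP: "p n1 = P" by (simp add: p_def P_def n_def)
  have hK: "real (h n1) = 128 * real N * real R * K * (real P + 1) * real (t P)"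
    by (simp add: h pP K_def algebra_simps)
  have h_ge: "2 * P \<le> h n1" "k \<le> h n1"
  proof -
    have dom: "2 * c \<le> h n1" if "h n1 = 128 * (c * d)" "0 < d" for c d
      using that by (cases d) simp_all
    have "h n1 = 128 * ((P + 1) * (N * R * (k + 1)\<^sup>2 * t P))"
      by (simp only: h pP ac_simps)
    then have "2 * (P + 1) \<le> h n1"
      by (rule dom) (use R \<open>0 < N\<close> t[of P] in simp)
    then show "2 * P \<le> h n1" by simp
    have "h n1 = 128 * ((k + 1)\<^sup>2 * (N * R * (P + 1) * t P))"
      by (simp only: h pP ac_simps)
    then have "2 * (k + 1)\<^sup>2 \<le> h n1"
      by (rule dom) (use R \<open>0 < N\<close> t[of P] in simp)
    moreover have "k \<le> 2 * (k + 1)\<^sup>2" by (simp add: power2_eq_square)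
    ultimately show "k \<le> h n1" by (rule order_trans[rotated])
  qed
  have \<delta>k: "\<delta> \<le> 1 / (real k + 1)"
    unfolding \<delta>_def using h_ge(2) by (intro divide_left_mono) auto
  have \<delta>h: "0 \<le> \<delta>" "\<delta> * real (h n1) \<le> 1"
    by (simp_all add: \<delta>_def)

  \<comment> \<open>Both half-steps contract; the one whose coefficients have the rate supplies the
    decay and the other factor is bounded by 1.\<close>
  obtain c where c: "rate_of_divergence \<Delta> c" "c = \<alpha> \<or> c = lam" using assms(17) by blast
  then have c01: "c i \<in> {0<..<1}" for i using assms(4,5) by auto
  define e where "e = 8 * (real (t P) / (1 / real R)) * real N * \<delta>"
  define V where "V i = max 0 ((norm (y (2 * i) - x))\<^sup>2 - \<epsilon>)" for i
  have e: "0 \<le> e" using \<delta>h by (simp add: e_def)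
  have "norm (y (2 * m) - x) \<le> 1 / (real k + 1)" if m: "m \<in> {n..f n}" for m
  proof -
    define L where "L = nat \<lceil>ln (16 * (real N)\<^sup>2 * (real k1 + 1))\<rceil>"
    have n_le: "\<Delta> (n1 + L) + 1 \<le> m" using m by (simp add: n_def sigma1_def L_def)
    note tail = rate_of_divergence_tail[OF c(1) c01 n_le]
    have mP: "m \<le> P" using m by (simp add: P_def)
    have step: "V (Suc i) \<le> (1 - c i) * V i + 2 * e" if i: "n1 \<le> i" "i < m" for i
    proof -
      define V' where "V' = max 0 ((norm (y (2 * i + 1) - x))\<^sup>2 - \<epsilon>)"
      \<comment> \<open>All indices up to \<open>P\<close> share the bound \<open>t P\<close>, which
        gives a uniform error \<open>e\<close> per half-step.\<close>
      have "t i \<le> t P" using i mP \<open>mono t\<close> by (simp add: monoD)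
      then have b: "\<beta> i \<le> real (t P)" "\<mu> i \<le> real (t P)"
        using \<beta>(2)[of i] \<mu>(2)[of i] by linarith+
      have "2 * i + 1 \<in> {n1..h n1}" "2 * i + 2 \<in> {n1..h n1}"
        using i mP h_ge(1) by auto
      then have pr: "(u - x) \<bullet> (y (2 * i + 1) - x) \<le> \<epsilon>" "(u - x) \<bullet> (y (2 * i + 2) - x) \<le> \<epsilon>"
        using proj K2 by (simp_all add: \<epsilon>_def)
      have s1: "V' \<le> (1 - \<alpha> i) * V i + e"
        unfolding V'_def V_def e_def
        by (rule resolvent_halpern_step_cball[OF assms(1) R(1) \<beta>(1) b(1) qA assms(4)
              u y x(1) assms(9) x(2)[folded \<delta>_def] pr(1)])
      have s2: "V (Suc i) \<le> (1 - lam i) * V' + e"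
        using resolvent_halpern_step_cball[OF assms(2) R(1) \<mu>(1) b(2) qB assms(5)
              u y x(1) assms(10) x(3)[folded \<delta>_def] pr(2)]
        by (simp add: V_def V'_def e_def)
      have pos: "0 \<le> V i" "0 \<le> V'" by (simp_all add: V_def V'_def)
      have \<alpha>: "0 \<le> \<alpha> i" "\<alpha> i \<le> 1" and lam: "0 \<le> lam i" "lam i \<le> 1"
        using assms(4)[of i] assms(5)[of i] by auto
      have "(1 - lam i) * V' \<le> (1 - lam i) * ((1 - \<alpha> i) * V i + e)"
        using s1 lam by (intro mult_left_mono) auto
      also have "\<dots> = (1 - lam i) * (1 - \<alpha> i) * V i + (1 - lam i) * e"
        by (simp add: algebra_simps)
      also have "\<dots> \<le> (1 - c i) * V i + 1 * e"
      proof (intro add_mono mult_right_mono)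
        have "(1 - lam i) * (1 - \<alpha> i) \<le> 1 * (1 - \<alpha> i)" "(1 - lam i) * (1 - \<alpha> i) \<le> (1 - lam i) * 1"
          using \<alpha> lam by (intro mult_right_mono mult_left_mono; simp)+
        then show "(1 - lam i) * (1 - \<alpha> i) \<le> 1 - c i" using c(2) by auto
      qed (use pos e lam in auto)
      finally show ?thesis using s2 by linarith
    qed
    have "V m \<le> exp (- (\<Sum>i=n1..<m. c i)) * V n1 + real (m - n1) * (2 * e)"
      using step e by (intro contraction_recursion_bound[OF tail(1) _ c01]) (auto simp: V_def)
    \<comment> \<open>The logarithm in \<open>sigma1\<close> is chosen so that the decay beats the
      initial \<open>(2 N)^2\<close> down to \<open>1 / (4 K)\<close>.\<close>
    moreover have "exp (- (\<Sum>i=n1..<m. c i)) * V n1 \<le> 1 / (16 * (real N)\<^sup>2 * K) * (4 * (real N)\<^sup>2)"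
    proof (intro mult_mono)
      have pos: "0 < 16 * (real N)\<^sup>2 * K" using \<open>0 < N\<close> K by simp
      have "ln (16 * (real N)\<^sup>2 * K) \<le> real L"
        unfolding L_def K1 by (rule real_nat_ceiling_ge)
      with tail(2) have "exp (- (\<Sum>i=n1..<m. c i)) \<le> exp (- ln (16 * (real N)\<^sup>2 * K))" by simp
      also have "\<dots> = 1 / (16 * (real N)\<^sup>2 * K)"
        using pos by (simp add: exp_minus inverse_eq_divide)
      finally show "exp (- (\<Sum>i=n1..<m. c i)) \<le> 1 / (16 * (real N)\<^sup>2 * K)" .
      have "(norm (y (2 * n1) - x))\<^sup>2 \<le> (2 * real N)\<^sup>2"
        using norm_diff_cball_le[OF y x(1)] by (intro power_mono) auto
      then show "V n1 \<le> 4 * (real N)\<^sup>2"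
        using K by (auto simp: V_def \<epsilon>_def power_mult_distrib intro: order_trans[rotated])
    qed (use K in \<open>auto simp: V_def\<close>)
    moreover have "1 / (16 * (real N)\<^sup>2 * K) * (4 * (real N)\<^sup>2) = 1 / (4 * K)"
      using \<open>0 < N\<close> by simp
    \<comment> \<open>At most \<open>P\<close> iterations with two half-steps each:
      \<open>h n1\<close> contains every factor of the accumulated error, and its constant 128
      leaves \<open>1 / (8 K)\<close>.\<close>
    moreover have "real (m - n1) * (2 * e) \<le> 1 / (8 * K)"
    proof -
      have "real (m - n1) * (2 * e) \<le> (real P + 1) * (2 * e)"
        using mP e by (intro mult_right_mono) auto
      also have "\<dots> = (\<delta> * real (h n1)) / (8 * K)"
        using K by (simp add: e_def hK)
      also have "\<dots> \<le> 1 / (8 * K)"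
        using \<delta>h K by (intro divide_right_mono) auto
      finally show ?thesis .
    qed
    ultimately have "V m \<le> 1 / (4 * K) + 1 / (8 * K)" by linarith
    then have "(norm (y (2 * m) - x))\<^sup>2 \<le> 1 / (4 * K) + 1 / (8 * K) + \<epsilon>"
      by (simp add: V_def)
    \<comment> \<open>The budget is \<open>1/4 + 1/8 + 1/16 = 7/16\<close> of
      \<open>1 / K\<close>.\<close>
    also have "\<dots> \<le> 1 / K" using K by (simp add: \<epsilon>_def field_simps)
    also have "\<dots> = (1 / (real k + 1))\<^sup>2" by (simp add: K_def power_divide)
    finally show ?thesis by (rule power2_le_imp_le) simp
  qed
  moreover have "n \<le> mu_bound \<Delta> t N R \<eta> k f"
    unfolding mu n_def using \<sigma> n1 by (rule monoD)
  moreover have "norm (?JA x - x) \<le> 1 / (real k + 1)" "norm (?JB x - x) \<le> 1 / (real k + 1)"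
    using x(2,3) \<delta>k unfolding \<delta>_def by linarith+
  ultimately show "\<exists>n \<le> mu_bound \<Delta> t N R \<eta> k f. \<exists>x \<in> ?B.
      \<forall>m\<in>{n..f n}. norm (y (2 * m) - x) \<le> 1 / (real k + 1) \<and>
        norm (?JA x - x) \<le> 1 / (real k + 1) \<and> norm (?JB x - x) \<le> 1 / (real k + 1)"
    using x(1) by blast
qed

end
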